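(* Let $\rho=\sqrt{1-t^2}$. Then, as formal power series in $x$ and $t$, \[ B(x,t)=\frac{1+\rho+2te^{\rho x}+(1-\rho)e^{2\rho x}}{1+\rho-t^2+(1-\rho-t^2)e^{2\rho x}}, \] and \[ A(x,t)=(1-t)B(x,t)=(1-t)\,\frac{1+\rho+2te^{\rho x}+(1-\rho)e^{2\rho x}}{1+\rho-t^2+(1-\rho-t^2)e^{2\rho x}}. \]
   Context: For a permutation $w=w_1\cdots w_n$ of $\{1,\dots,n\}$, a subsequence $w_{i_1}\cdots w_{i_k}$ ($i_1<\cdots<i_k$) is alternating if $w_{i_1}>w_{i_2}<w_{i_3}>w_{i_4}<\cdots$ (starting with a descent; length-$1$ sequences are alternating). Let $\mathrm{as}(w)$ be the maximum length of an alternating subsequence of $w$ (with $\mathrm{as}=0$ for the empty permutation, $n=0$). For $k,n\ge0$ let $a_k(n)=\#\{w\in\mathfrak{S}_n:\mathrm{as}(w)=k\}$ and $b_k(n)=\#\{w\in\mathfrak{S}_n:\mathrm{as}(w)\le k\}=a_0(n)+a_1(n)+\cdots+a_k(n)$, where $\mathfrak{S}_n$ is the symmetric group on $\{1,\dots,n\}$. Define $A(x,t)=\sum_{k,n\ge0}a_k(n)t^k\frac{x^n}{n!}$ and $B(x,t)=\sum_{k,n\ge0}b_k(n)t^k\frac{x^n}{n!}$. Here $\sqrt{1-t^2}$ denotes the power series in $t$ with constant term $1$. *)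

theory Defs
  imports
    "HOL-Library.Sublist"
    "HOL-Combinatorics.Multiset_Permutations"
    "HOL-Computational_Algebra.Formal_Power_Series"
begin

section \<open>Alternating subsequences of permutations\<close>

text \<open>
  Permutations of \<open>{1..n}\<close> are written as words, i.e. as the lists in
  \<^term>\<open>permutations_of_set {1..n::nat}\<close>. List positions count from 0, so even positions carry
  the descents. The empty list also counts as alternating; this affects \<open>as_len\<close> only for the
  empty word, where it yields 0.
\<close>

definition alternating :: "nat list \<Rightarrow> bool" where
  "alternating u \<longleftrightarrow>
     (\<forall>i. Suc i < length u \<longrightarrow> (if even i then u ! i > u ! Suc i else u ! i < u ! Suc i))"

definition as_len :: "nat list \<Rightarrow> nat" where
  "as_len w = Max {length u | u. subseq u w \<and> alternating u}"

definition a_num :: "nat \<Rightarrow> nat \<Rightarrow> nat" where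
  "a_num k n = card {w \<in> permutations_of_set {1..n}. as_len w = k}"

definition b_num :: "nat \<Rightarrow> nat \<Rightarrow> nat" where
  "b_num k n = card {w \<in> permutations_of_set {1..n}. as_len w \<le> k}"

lemma b_num_eq_sum: "b_num k n = (\<Sum>j\<le>k. a_num j n)"
proof -
  let ?S = "\<lambda>j. {w \<in> permutations_of_set {1..n}. as_len w = j}"
  have "{w \<in> permutations_of_set {1..n}. as_len w \<le> k} = (\<Union>j\<in>{..k}. ?S j)"
    by blast
  also have "card \<dots> = (\<Sum>j\<in>{..k}. card (?S j))"
    by (rule card_UN_disjoint) auto
  finally show ?thesis
    unfolding a_num_def b_num_def .
qed

lemma as_len_Nil: "as_len [] = 0"
proof -
  have alt: "alternating []"
    by (simp add: alternating_def)
  have iff: "subseq u [] \<longleftrightarrow> u = []" for u :: "nat list"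
    by (cases u) simp_all
  have "{length u | u. subseq u [] \<and> alternating u} = {0}"
    unfolding iff using alt by force
  then show ?thesis
    unfolding as_len_def by (simp only: Max_singleton)
qed

lemma finite_alternating_lengths: "finite {length u | u. subseq u w \<and> alternating u}"
proof (rule finite_subset)
  show "{length u | u. subseq u w \<and> alternating u} \<subseteq> {..length w}"
    using list_emb_length by fastforce
qed simp


section \<open>Power series in \<open>x\<close> and \<open>t\<close>\<close>

text \<open>
  The ring \<open>\<real>[[t]][[x]]\<close> is the type \<^typ>\<open>real fps fps\<close>: the outer variable is \<open>x\<close>, and the
  coefficients are power series in \<open>t\<close>.
\<close>

definition A_gf :: "real fps fps" where
  "A_gf = Abs_fps (\<lambda>n. Abs_fps (\<lambda>k. real (a_num k n) / fact n))"

definition B_gf :: "real fps fps" where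
  "B_gf = Abs_fps (\<lambda>n. Abs_fps (\<lambda>k. real (b_num k n) / fact n))"

definition t_var :: "real fps fps" where
  "t_var = fps_const fps_X"

definition rho_t :: "real fps" where
  "rho_t = fps_radical root 2 (1 - fps_X ^ 2)"

definition rho :: "real fps fps" where
  "rho = fps_const rho_t"

text \<open>
  \<open>exp_x c\<close> is the series \<open>e\<^sup>c\<^sup>x\<close> for \<open>c \<in> \<real>[[t]]\<close>. The library's \<^const>\<open>fps_exp\<close> is only
  available over a field of coefficients.
\<close>

definition exp_x :: "real fps \<Rightarrow> real fps fps" where
  "exp_x c = Abs_fps (\<lambda>n. fps_const (1 / fact n) * c ^ n)"

lemma rho_t_nth_0: "fps_nth rho_t 0 = 1"
  by (simp add: rho_t_def)

lemma rho_t_power2: "rho_t ^ 2 = 1 - fps_X ^ 2"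
proof -
  have "fps_radical root (Suc 1) (1 - fps_X ^ 2 :: real fps) ^ Suc 1 = 1 - fps_X ^ 2"
    by (subst power_radical[symmetric]) auto
  then show ?thesis by (simp add: rho_t_def numeral_2_eq_2)
qed

lemma rho_power2: "rho ^ 2 = 1 - t_var ^ 2"
proof -
  have "rho ^ 2 = fps_const (1 - fps_X ^ 2)"
    by (simp only: rho_def fps_const_power rho_t_power2)
  also have "\<dots> = 1 - t_var ^ 2"
    by (simp only: t_var_def fps_const_power fps_const_sub[symmetric] fps_const_1_eq_1)
  finally show ?thesis .
qed

text \<open>
  Since \<open>\<real>[[t]]\<close> is not a field, the following records that \<open>/\<close> on \<open>\<real>[[t]][[x]]\<close> is
  genuine division when the divisor has nonzero constant term.
\<close>

lemma fps_fps_divide_mult_cancel: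
  fixes f g :: "real fps fps"
  assumes "fps_nth (fps_nth g 0) 0 \<noteq> 0"
  shows "f / g * g = f"
proof -
  have "inverse (fps_nth g 0) * fps_nth g 0 = 1" "fps_nth g 0 * inverse (fps_nth g 0) = 1"
    using inverse_mult_eq_1'[OF assms] inverse_mult_eq_1[OF assms] by simp_all
  then have inv: "inverse g * g = 1"
    unfolding fps_inverse_def[of g] by (rule fps_left_inverse')
  have "fps_nth g 0 \<noteq> 0" using assms by auto
  then have sd: "subdegree g = 0" by simp
  then have "f / g = f * inverse g"
    by (simp add: fps_divide_def)
  then show ?thesis using inv by (simp add: mult.assoc)
qed

lemma denominator_nth_0_0:
  "fps_nth (fps_nth (1 + rho - t_var ^ 2 + (1 - rho - t_var ^ 2) * exp_x (2 * rho_t)) 0) 0 = 2"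
  by (simp add: rho_def t_var_def exp_x_def rho_t_nth_0)

end

theory Submission
  imports Defs "HOL-Library.Infinite_Set"
begin

unbundle fps_syntax

text \<open>
  Splitting a word at its maximum, \<open>w = u m v\<close>, gives \<open>as w = 2\<lfloor>as u / 2\<rfloor> + 1 + as' v\<close>, where \<open>as'\<close> counts
  ascent-first alternating subsequences and is equidistributed with \<open>as\<close> by complementation. Hence
  the exponential generating functions \<open>G\<close>, \<open>H\<close> of \<open>t\<close> to the powers \<open>2\<lfloor>as w / 2\<rfloor>\<close>, \<open>2\<lceil>as w / 2\<rceil>\<close>
  satisfy the closed system \<open>G' = G H\<close>, \<open>H' = t\<^sup>2 G\<^sup>2\<close>, which has an explicit solution, and
  \<open>(1 + t) A = H + t G\<close>.
\<close>

section \<open>Alternating sequences with a prescribed first direction\<close>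

text \<open>The flag keeps tails and complements of alternating sequences in one family;
  \<open>True\<close> stands for descent-first.\<close>

fun alternates :: "bool \<Rightarrow> nat list \<Rightarrow> bool" where
  "alternates d (x # y # w) \<longleftrightarrow> (if d then y < x else x < y) \<and> alternates (\<not> d) (y # w)"
| "alternates d w \<longleftrightarrow> True"

definition alt_len :: "bool \<Rightarrow> nat list \<Rightarrow> nat" where
  "alt_len d w = Max {length u | u. subseq u w \<and> alternates d u}"

lemma alternates_iff_nth:
  "alternates d u \<longleftrightarrow>
     (\<forall>i. Suc i < length u \<longrightarrow> (if even i = d then u ! i > u ! Suc i else u ! i < u ! Suc i))"
proof (induction d u rule: alternates.induct)
  case (1 d x y w)
  have all_split: "(\<forall>i. P i) \<longleftrightarrow> P 0 \<and> (\<forall>i. P (Suc i))" for P :: "nat \<Rightarrow> bool"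
    by (metis nat.exhaust)
  show ?case
    by (subst all_split) (use 1 in auto)
qed auto

lemma alternating_iff: "alternating u \<longleftrightarrow> alternates True u"
  by (simp add: alternating_def alternates_iff_nth)

lemma as_len_eq_alt_len: "as_len w = alt_len True w"
  by (simp add: as_len_def alt_len_def alternating_iff)

lemma finite_alternates_lengths: "finite {length u | u. subseq u w \<and> alternates d u}"
  by (rule finite_subset[of _ "{..length w}"]) (use list_emb_length in fastforce)+

lemma length_le_alt_len: "subseq u w \<Longrightarrow> alternates d u \<Longrightarrow> length u \<le> alt_len d w"
  unfolding alt_len_def by (rule Max_ge[OF finite_alternates_lengths]) blast

lemma alt_len_attained:
  obtains u where "subseq u w" "alternates d u" "length u = alt_len d w"
proof -
  have "{length u | u. subseq u w \<and> alternates d u} \<noteq> {}"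
    using alternates.simps(2)[of d] by blast
  from Max_in[OF finite_alternates_lengths this] show ?thesis
    using that unfolding alt_len_def by auto
qed

text \<open>Every letter flips the direction, so the parity of \<open>length u\<close> fixes the
  direction in which \<open>v\<close> starts. The step across the junction comes one position
  earlier and therefore has the opposite direction.\<close>

lemma alternates_append:
  "alternates d (u @ v) \<longleftrightarrow>
     alternates d u \<and> alternates (d = even (length u)) v \<and>
     (u \<noteq> [] \<longrightarrow> v \<noteq> [] \<longrightarrow>
       (if d = odd (length u) then hd v < last u else last u < hd v))"
proof (induction d u rule: alternates.induct)
  case (1 d x y w)
  then show ?case by auto
next
  case ("2_2" d x)
  then show ?case by (cases v) auto
qed auto

lemma alternates_tl: "alternates d w \<Longrightarrow> alternates (\<not> d) (tl w)"
  by (induction d w rule: alternates.induct) auto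

lemma alternates_map_mono:
  assumes "strict_mono_on A f" "set u \<subseteq> A"
  shows "alternates d (map f u) \<longleftrightarrow> alternates d u"
  using assms(2)
  by (induction d u rule: alternates.induct)
     (auto simp: strict_mono_on_less[OF assms(1)])

lemma alternates_map_antimono:
  assumes "\<And>x y. x \<in> A \<Longrightarrow> y \<in> A \<Longrightarrow> f x < f y \<longleftrightarrow> y < x" "set u \<subseteq> A"
  shows "alternates d (map f u) \<longleftrightarrow> alternates (\<not> d) u"
  using assms(2)
  by (induction d u rule: alternates.induct) (auto simp: assms(1))

text \<open>Selecting positions commutes with \<open>map\<close>, so the subsequences of
  \<open>map f w\<close> are the images of those of \<open>w\<close>, with equal lengths.\<close>

lemma alt_len_map:
  assumes "\<And>u. set u \<subseteq> set w \<Longrightarrow> alternates d (map f u) \<longleftrightarrow> alternates e u"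
  shows "alt_len d (map f w) = alt_len e w"
proof -
  have "{length u | u. subseq u (map f w) \<and> alternates d u} =
        {length u | u. subseq u w \<and> alternates e u}"
    unfolding subseq_conv_nths nths_map
    using assms[of "nths w _"] set_nths_subset[of w]
    by (auto simp: nths_map) (metis length_map)+
  then show ?thesis by (simp add: alt_len_def)
qed

section \<open>Splitting a word at its maximum\<close>

lemma set_mono_subseq: "subseq u w \<Longrightarrow> set u \<subseteq> set w"
  by (auto elim: list_emb_set)

text \<open>
  A maximum in a descent-first alternating sequence can only be a peak, so the part before it may be
  cut to even length, and any peak after it may be replaced by it.
\<close>

lemma alt_len_split_max:
  assumes less: "\<And>x. x \<in> set u \<Longrightarrow> x < m" "\<And>x. x \<in> set v \<Longrightarrow> x < m"
  shows "alt_len True (u @ m # v) = 2 * (alt_len True u div 2) + 1 + alt_len False v"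
proof (rule antisym)
  obtain p where p: "subseq p (u @ m # v)" "alternates True p"
      "length p = alt_len True (u @ m # v)"
    by (rule alt_len_attained)
  from p(1) obtain p1 p2 where p12: "p = p1 @ p2" "subseq p1 u" "subseq p2 (m # v)"
    by (auto simp: subseq_append_iff)
  have alt: "alternates True p1" "alternates (even (length p1)) p2"
    using p(2) unfolding p12 alternates_append by auto
  have le1: "length p1 \<le> alt_len True u"
    using p12 alt by (intro length_le_alt_len)
  have tl: "subseq (tl p2) v"
    using p12(3) by (cases p2) (auto dest: subseq_Cons' split: if_splits)
  show "alt_len True (u @ m # v) \<le> 2 * (alt_len True u div 2) + 1 + alt_len False v"
  \<comment> \<open>In the even case \<open>p2\<close> is descent-first, so its tail is ascent-first
    inside \<open>v\<close>. In the odd case the junction is a descent, so \<open>p2\<close> cannot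
    start with \<open>m\<close> and lies wholly in \<open>v\<close>.\<close>
  proof (cases "even (length p1)")
    case True
    then have "alternates False (tl p2)" using alternates_tl alt(2) by force
    then have "length p2 \<le> 1 + alt_len False v"
      using length_le_alt_len[OF tl] by fastforce
    moreover have "length p1 \<le> 2 * (alt_len True u div 2)" using True le1 by presburger
    ultimately show ?thesis using p(3) p12(1) by simp
  next
    case False
    have "subseq p2 v"
    proof (cases "p2 \<noteq> [] \<and> hd p2 = m")
      case True
      have "p1 \<noteq> []" using False by auto
      then have "last p1 \<in> set u" using set_mono_subseq[OF p12(2)] by auto
      moreover have "m < last p1"
        using p(2) False True \<open>p1 \<noteq> []\<close> unfolding p12 alternates_append by auto
      ultimately show ?thesis using less(1) by fastforce
    next
      case False
      then show ?thesis using p12(3) by (cases p2) (auto split: if_splits)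
    qed
    then have "length p2 \<le> alt_len False v"
      using alt(2) False by (intro length_le_alt_len) auto
    moreover have "length p1 \<le> 2 * (alt_len True u div 2) + 1" using le1 by presburger
    ultimately show ?thesis using p(3) p12(1) by simp
  qed
next
  obtain p where p: "subseq p u" "alternates True p" "length p = alt_len True u"
    by (rule alt_len_attained)
  obtain q where q: "subseq q v" "alternates False q" "length q = alt_len False v"
    by (rule alt_len_attained)
  \<comment> \<open>After an even number of letters the next one is a peak, so \<open>m\<close> fits
    there.\<close>
  define r where "r = take (2 * (alt_len True u div 2)) p"
  have r: "alternates True r" "subseq r u" "length r = 2 * (alt_len True u div 2)"
  proof -
    have pr: "p = r @ drop (2 * (alt_len True u div 2)) p" by (simp add: r_def)
    show "alternates True r" using p(2) by (subst (asm) pr) (simp only: alternates_append)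
    show "subseq r u"
      using p(1) unfolding r_def
      by (meson prefix_imp_subseq subseq_order.trans take_is_prefix)
    show "length r = 2 * (alt_len True u div 2)" using p(3) by (simp add: r_def)
  qed
  have "alternates True (m # q)"
    using q(1,2) less(2) by (cases q) (auto dest: set_mono_subseq)
  moreover have "last r < m" if "r \<noteq> []"
    using less(1) set_mono_subseq[OF r(2)] last_in_set[OF that] by blast
  ultimately have "alternates True (r @ m # q)"
    using r by (auto simp: alternates_append)
  moreover have "subseq (r @ m # q) (u @ m # v)"
    using r q by (simp add: list_emb_append_mono)
  ultimately show "2 * (alt_len True u div 2) + 1 + alt_len False v \<le> alt_len True (u @ m # v)"
    using length_le_alt_len[of "r @ m # q"] r(3) q(3) by fastforce
qed

section \<open>Weighted sums over permutations and their recurrence\<close>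

text \<open>On \<open>{..<n}\<close> the next letter \<open>n\<close> is the new maximum. A general
  weight covers all the series in play at once.\<close>

definition perm_sum :: "(nat \<Rightarrow> real fps) \<Rightarrow> nat \<Rightarrow> real fps" where
  "perm_sum \<phi> n = (\<Sum>w\<in>permutations_of_set {..<n}. \<phi> (alt_len True w))"

lemma perm_sum_relabel:
  assumes "inj_on f {..<n}" "f ` {..<n} = A"
    "\<And>u. set u \<subseteq> {..<n} \<Longrightarrow> alternates d (map f u) \<longleftrightarrow> alternates True u"
  shows "(\<Sum>w\<in>permutations_of_set A. \<phi> (alt_len d w)) = perm_sum \<phi> n"
proof -
  have "inj_on (map f) (permutations_of_set {..<n})"
    using assms(1) by (intro inj_on_mapI inj_on_subset[OF assms(1)]) (auto dest: permutations_of_setD)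
  then have "(\<Sum>w\<in>permutations_of_set A. \<phi> (alt_len d w)) =
      (\<Sum>w\<in>permutations_of_set {..<n}. \<phi> (alt_len d (map f w)))"
    unfolding assms(2)[symmetric] permutations_of_set_image_inj[OF assms(1)]
    by (simp add: sum.reindex)
  also have "\<dots> = perm_sum \<phi> n"
    unfolding perm_sum_def
    by (intro sum.cong refl arg_cong[of _ _ \<phi>] alt_len_map assms(3)) (auto dest: permutations_of_setD)
  finally show ?thesis .
qed

text \<open>Only the relative order of the letters matters. The increasing bijection
  \<open>h\<close> settles \<open>d = True\<close>; composed with the reversal of
  \<open>{..<card A}\<close> it exchanges ascents and descents and settles \<open>d = False\<close>.
  This is the equidistribution of the two statistics.\<close>

lemma perm_sum_card:
  assumes "finite A"
  shows "(\<Sum>w\<in>permutations_of_set A. \<phi> (alt_len d w)) = perm_sum \<phi> (card A)"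
proof -
  obtain h where h: "bij_betw h {..<card A} A" "strict_mono_on {..<card A} h"
    using ex_bij_betw_strict_mono_card[OF assms] .
  show ?thesis
  proof (cases d)
    case True
    then show ?thesis
      using h alternates_map_mono[OF h(2)]
      by (intro perm_sum_relabel[of h]) (auto simp: bij_betw_def)
  next
    case False
    define f where "f = h \<circ> (\<lambda>i. card A - Suc i)"
    have bij: "bij_betw (\<lambda>i. card A - Suc i) {..<card A} {..<card A}"
      by (rule bij_betw_byWitness[of _ "\<lambda>i. card A - Suc i"]) auto
    have "bij_betw f {..<card A} A"
      unfolding f_def by (rule bij_betw_trans[OF bij h(1)])
    moreover have "f x < f y \<longleftrightarrow> y < x" if "x \<in> {..<card A}" "y \<in> {..<card A}" for x y
      using that strict_mono_on_less[OF h(2), of "card A - Suc x" "card A - Suc y"]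
      by (auto simp: f_def)
    ultimately show ?thesis
      using False alternates_map_antimono[of "{..<card A}" f]
      by (intro perm_sum_relabel[of f]) (auto simp: bij_betw_def)
  qed
qed

text \<open>Since \<open>m\<close> occurs exactly once, a word is determined by the parts before and
  after it; \<open>S\<close> collects the letters before it.\<close>

lemma sum_permutations_insert:
  fixes f :: "'a list \<Rightarrow> 'b::comm_monoid_add"
  assumes "finite A" "m \<notin> A"
  shows "(\<Sum>w\<in>permutations_of_set (insert m A). f w) =
    (\<Sum>S\<in>Pow A. \<Sum>u\<in>permutations_of_set S. \<Sum>v\<in>permutations_of_set (A - S). f (u @ m # v))"
proof -
  let ?D = "SIGMA S:Pow A. permutations_of_set S \<times> permutations_of_set (A - S)"
  have "bij_betw (\<lambda>(S, u, v). u @ m # v) ?D (permutations_of_set (insert m A))"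
    unfolding bij_betw_def
  proof (intro conjI subset_antisym subsetI)
    show "inj_on (\<lambda>(S, u, v). u @ m # v) ?D"
    proof (rule inj_onI, clarsimp)
      fix S u v S' u' v'
      assume *: "u @ m # v = u' @ m # v'" "S \<subseteq> A" "S' \<subseteq> A"
        "u \<in> permutations_of_set S" "u' \<in> permutations_of_set S'"
      then have "m \<notin> set u" "m \<notin> set u'" "set u = S" "set u' = S'"
        using assms(2) by (auto dest: permutations_of_setD)
      with *(1) show "S = S' \<and> u = u' \<and> v = v'"
        by (auto simp: append_eq_append_conv2 append_eq_Cons_conv Cons_eq_append_conv)
    qed
  next
    fix w assume "w \<in> (\<lambda>(S, u, v). u @ m # v) ` ?D"
    then show "w \<in> permutations_of_set (insert m A)"
      using assms(2) by (auto simp: permutations_of_set_def)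
  next
    fix w assume w: "w \<in> permutations_of_set (insert m A)"
    then obtain u v where uv: "w = u @ m # v"
      by (metis insertI1 permutations_of_setD(1) split_list)
    have "(set u, u, v) \<in> ?D"
      using w assms(2) unfolding uv
      by (auto simp: permutations_of_set_def)
    then show "w \<in> (\<lambda>(S, u, v). u @ m # v) ` ?D"
      unfolding uv by (intro image_eqI[of _ _ "(set u, u, v)"]) auto
  qed
  then have "(\<Sum>w\<in>permutations_of_set (insert m A). f w) = (\<Sum>(S, u, v)\<in>?D. f (u @ m # v))"
    by (subst sum.reindex_bij_betw[symmetric]) (auto simp: case_prod_unfold)
  also have "\<dots> = (\<Sum>S\<in>Pow A. \<Sum>(u, v)\<in>permutations_of_set S \<times> permutations_of_set (A - S). f (u @ m # v))"
    using assms(1) by (subst sum.Sigma) (auto simp: case_prod_unfold)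
  also have "\<dots> = (\<Sum>S\<in>Pow A. \<Sum>u\<in>permutations_of_set S. \<Sum>v\<in>permutations_of_set (A - S). f (u @ m # v))"
    by (simp add: sum.cartesian_product)
  finally show ?thesis .
qed

lemma sum_Pow_card:
  fixes g :: "nat \<Rightarrow> 'a::comm_semiring_1"
  assumes "finite A"
  shows "(\<Sum>S\<in>Pow A. g (card S)) = (\<Sum>k\<le>card A. of_nat (card A choose k) * g k)"
proof -
  have "(\<Sum>S\<in>Pow A. g (card S)) = (\<Sum>k\<le>card A. \<Sum>S\<in>{S \<in> Pow A. card S = k}. g (card S))"
    using assms by (intro sum.group[symmetric]) (auto intro: card_mono)
  also have "\<dots> = (\<Sum>k\<le>card A. of_nat (card A choose k) * g k)"
    using n_subsets[OF assms] by (intro sum.cong) auto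
  finally show ?thesis .
qed

text \<open>The hypothesis says that the weight factors across the split at the maximum
  \<open>n\<close>. The binomial coefficient counts the letter sets of the left part, and
  \<open>perm_sum_card\<close> turns the ascent-first statistic of the right part into the
  descent-first one.\<close>

lemma perm_sum_Suc:
  assumes "\<And>a b. \<phi> (2 * (a div 2) + 1 + b) = c * \<phi>1 a * \<phi>2 b"
  shows "perm_sum \<phi> (Suc n) =
    c * (\<Sum>k\<le>n. of_nat (n choose k) * (perm_sum \<phi>1 k * perm_sum \<phi>2 (n - k)))"
proof -
  have "perm_sum \<phi> (Suc n) = (\<Sum>S\<in>Pow {..<n}. \<Sum>u\<in>permutations_of_set S.
      \<Sum>v\<in>permutations_of_set ({..<n} - S). \<phi> (alt_len True (u @ n # v)))"
    unfolding perm_sum_def lessThan_Suc by (rule sum_permutations_insert) auto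
  also have "\<dots> = (\<Sum>S\<in>Pow {..<n}. \<Sum>u\<in>permutations_of_set S.
      \<Sum>v\<in>permutations_of_set ({..<n} - S).
        c * (\<phi>1 (alt_len True u) * \<phi>2 (alt_len False v)))"
  proof (intro sum.cong refl)
    fix S u v
    assume "S \<in> Pow {..<n}" "u \<in> permutations_of_set S" "v \<in> permutations_of_set ({..<n} - S)"
    then have "set u \<subseteq> {..<n}" "set v \<subseteq> {..<n}" by (auto dest: permutations_of_setD)
    then have "alt_len True (u @ n # v) = 2 * (alt_len True u div 2) + 1 + alt_len False v"
      by (intro alt_len_split_max) auto
    then show "\<phi> (alt_len True (u @ n # v)) = c * (\<phi>1 (alt_len True u) * \<phi>2 (alt_len False v))"
      by (simp only: assms mult.assoc)
  qed
  also have "\<dots> = c * (\<Sum>S\<in>Pow {..<n}. (\<Sum>u\<in>permutations_of_set S. \<phi>1 (alt_len True u)) *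
      (\<Sum>v\<in>permutations_of_set ({..<n} - S). \<phi>2 (alt_len False v)))"
    unfolding sum_product by (simp only: sum_distrib_left)
  also have "\<dots> = c * (\<Sum>S\<in>Pow {..<n}. perm_sum \<phi>1 (card S) * perm_sum \<phi>2 (n - card S))"
    by (intro arg_cong[of _ _ "\<lambda>x. c * x"] sum.cong refl arg_cong2[of _ _ _ _ "(*)"])
       (auto simp: perm_sum_card card_Diff_subset finite_subset[of _ "{..<n}"])
  also have "\<dots> = c * (\<Sum>k\<le>n. of_nat (n choose k) * (perm_sum \<phi>1 k * perm_sum \<phi>2 (n - k)))"
    by (subst sum_Pow_card) auto
  finally show ?thesis .
qed

section \<open>Exponential generating functions and their differential system\<close>

definition perm_gf :: "(nat \<Rightarrow> real fps) \<Rightarrow> real fps fps" where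
  "perm_gf \<phi> = Abs_fps (\<lambda>n. fps_const (1 / fact n) * perm_sum \<phi> n)"

text \<open>The derivative shifts the index by one, which matches removing the maximum, and a
  binomial convolution becomes a product of exponential series.\<close>

lemma fps_deriv_perm_gf:
  assumes "\<And>a b. \<phi> (2 * (a div 2) + 1 + b) = c * \<phi>1 a * \<phi>2 b"
  shows "fps_deriv (perm_gf \<phi>) = fps_const c * (perm_gf \<phi>1 * perm_gf \<phi>2)"
proof (rule fps_ext)
  fix n
  \<comment> \<open>The factorial identity is proved over the reals and carried over by
    \<open>fps_const\<close>, as the series in \<open>t\<close> do not form a field.\<close>
  have coeff: "fps_const (real (Suc n) * (1 / fact (Suc n))) * of_nat (n choose k) =
      (fps_const (1 / fact k) * fps_const (1 / fact (n - k)) :: real fps)" if "k \<le> n" for k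
  proof -
    have "real (Suc n) * (1 / fact (Suc n)) = 1 / fact n"
      by (simp only: fact_Suc of_nat_mult) simp
    then have "real (Suc n) * (1 / fact (Suc n)) * real (n choose k) = 1 / fact k * (1 / fact (n - k))"
      using binomial_fact[OF that, where 'a = real] by simp
    then show ?thesis
      by (metis fps_of_nat fps_const_mult)
  qed
  have "fps_deriv (perm_gf \<phi>) $ n =
      fps_const (real (Suc n) * (1 / fact (Suc n))) * perm_sum \<phi> (Suc n)"
    by (simp only: perm_gf_def fps_deriv_nth fps_nth_Abs_fps Suc_eq_plus1[symmetric] fps_of_nat[symmetric]
        mult.assoc[symmetric] fps_const_mult)
  also have "\<dots> = c * (\<Sum>k\<le>n. (fps_const (real (Suc n) * (1 / fact (Suc n))) * of_nat (n choose k)) *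
      (perm_sum \<phi>1 k * perm_sum \<phi>2 (n - k)))"
    unfolding perm_sum_Suc[of \<phi> c \<phi>1 \<phi>2, OF assms] sum_distrib_left by (simp only: mult_ac)
  also have "\<dots> = c * (\<Sum>k\<le>n. (fps_const (1 / fact k) * perm_sum \<phi>1 k) *
      (fps_const (1 / fact (n - k)) * perm_sum \<phi>2 (n - k)))"
  proof (intro arg_cong[of _ _ "\<lambda>x. c * x"] sum.cong refl)
    fix k assume "k \<in> {..n}"
    then show "fps_const (real (Suc n) * (1 / fact (Suc n))) * of_nat (n choose k) *
        (perm_sum \<phi>1 k * perm_sum \<phi>2 (n - k)) =
      fps_const (1 / fact k) * perm_sum \<phi>1 k * (fps_const (1 / fact (n - k)) * perm_sum \<phi>2 (n - k))"
      unfolding coeff[OF \<open>k \<in> {..n}\<close>[unfolded atMost_iff]] by (simp only: mult_ac)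
  qed
  also have "\<dots> = (fps_const c * (perm_gf \<phi>1 * perm_gf \<phi>2)) $ n"
    unfolding fps_mult_left_const_nth by (simp add: fps_mult_nth perm_gf_def atLeast0AtMost)
  finally show "fps_deriv (perm_gf \<phi>) $ n = (fps_const c * (perm_gf \<phi>1 * perm_gf \<phi>2)) $ n" .
qed

lemma perm_gf_nth_0: "perm_gf \<phi> $ 0 = \<phi> 0"
proof -
  have "alt_len True [] = 0" using as_len_Nil by (simp add: as_len_eq_alt_len)
  then show ?thesis by (simp add: perm_gf_def perm_sum_def)
qed

text \<open>Even exponents suit the split because the left part enters it only through
  \<open>a div 2\<close>.\<close>

definition floor_gf :: "real fps fps" where
  "floor_gf = perm_gf (\<lambda>a. fps_X ^ (2 * (a div 2)))"

definition ceil_gf :: "real fps fps" where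
  "ceil_gf = perm_gf (\<lambda>a. fps_X ^ (2 * (Suc a div 2)))"

text \<open>In exponents of \<open>t\<close> squared, this factorization yields the product
  \<open>floor_gf * ceil_gf\<close>.\<close>

lemma div2_split:
  "(2 * (a div 2) + 1 + b) div 2 = a div 2 + Suc b div 2" for a b :: nat
  by presburger

text \<open>Here both factors are floors, and the summand 1 becomes the factor
  \<open>t_var ^ 2\<close>.\<close>

lemma Suc_div2_split:
  "Suc (2 * (a div 2) + 1 + b) div 2 = 1 + a div 2 + b div 2" for a b :: nat
  by presburger

lemma fps_deriv_floor_gf: "fps_deriv floor_gf = floor_gf * ceil_gf"
proof -
  have "fps_deriv floor_gf = fps_const 1 * (floor_gf * ceil_gf)"
    unfolding floor_gf_def ceil_gf_def
    by (rule fps_deriv_perm_gf) (simp only: div2_split distrib_left power_add mult_1)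
  then show ?thesis by simp
qed

lemma fps_deriv_ceil_gf: "fps_deriv ceil_gf = t_var ^ 2 * floor_gf ^ 2"
proof -
  have "fps_deriv ceil_gf = fps_const (fps_X ^ 2) * (floor_gf * floor_gf)"
    unfolding floor_gf_def ceil_gf_def
    by (rule fps_deriv_perm_gf)
       (simp only: Suc_div2_split distrib_left power_add mult_1 mult_1_right)
  then show ?thesis by (simp add: t_var_def power2_eq_square)
qed

lemma A_gf_eq_perm_gf: "A_gf = perm_gf (\<lambda>a. fps_X ^ a)"
proof (rule fps_ext)+
  fix n k
  have "perm_sum (\<lambda>a. fps_X ^ a) n = (\<Sum>w\<in>permutations_of_set {1..n}. fps_X ^ as_len w)"
    using perm_sum_card[of "{1..n}" "\<lambda>a. fps_X ^ a" True] by (simp add: as_len_eq_alt_len)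
  then have "perm_sum (\<lambda>a. fps_X ^ a) n $ k =
      (\<Sum>w\<in>permutations_of_set {1..n}. if as_len w = k then 1 else 0)"
    by (auto simp: fps_sum_nth fps_X_power_nth intro!: sum.cong)
  also have "\<dots> = real (a_num k n)"
    unfolding a_num_def by (simp add: sum.inter_filter[symmetric])
  finally show "A_gf $ n $ k = perm_gf (\<lambda>a. fps_X ^ a) $ n $ k"
    by (simp add: A_gf_def perm_gf_def)
qed

text \<open>Multiplying by \<open>1 - t_var\<close> takes successive differences in
  \<open>k\<close>, which undoes the partial sums.\<close>

lemma A_gf_eq_B_gf: "A_gf = (1 - t_var) * B_gf"
proof (rule fps_ext)+
  fix n k
  have "((1 - t_var) * B_gf) $ n = (1 - fps_X) * Abs_fps (\<lambda>k. real (b_num k n) / fact n)"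
    by (simp add: t_var_def B_gf_def algebra_simps)
  also have "\<dots> $ k = real (a_num k n) / fact n"
    by (cases k) (simp_all add: algebra_simps b_num_eq_sum add_divide_distrib)
  finally show "A_gf $ n $ k = ((1 - t_var) * B_gf) $ n $ k"
    by (simp add: A_gf_def)
qed

text \<open>
  Both sides weigh \<open>w\<close> by the same two powers of \<open>t\<close>: \<open>as w\<close> and \<open>as w + 1\<close> are, in some order, the
  even number \<open>2\<lceil>as w / 2\<rceil>\<close> and the odd number \<open>2\<lfloor>as w / 2\<rfloor> + 1\<close>.
\<close>

lemma A_gf_eq_floor_ceil: "(1 + t_var) * A_gf = ceil_gf + t_var * floor_gf"
proof (rule fps_ext)
  fix n
  have eq: "(1 + fps_X) * (fps_X :: real fps) ^ a = fps_X ^ (2 * (Suc a div 2)) + fps_X * fps_X ^ (2 * (a div 2))"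
    for a :: nat
    by (cases "even a") (auto elim!: evenE oddE simp: distrib_right)
  have "(1 + fps_X) * perm_sum (\<lambda>a. fps_X ^ a) n =
      perm_sum (\<lambda>a. fps_X ^ (2 * (Suc a div 2))) n + fps_X * perm_sum (\<lambda>a. fps_X ^ (2 * (a div 2))) n"
    unfolding perm_sum_def sum_distrib_left eq sum.distrib ..
  then show "((1 + t_var) * A_gf) $ n = (ceil_gf + t_var * floor_gf) $ n"
    unfolding A_gf_eq_perm_gf floor_gf_def ceil_gf_def perm_gf_def t_var_def
    by (simp add: distrib_right) (simp only: distrib_left[symmetric] mult.left_commute[of fps_X])
qed

section \<open>Uniqueness for differential equations of formal power series\<close>

lemma fps_nth_Suc_eqI:
  fixes F G :: "'a::{idom,semiring_char_0} fps"
  assumes "fps_deriv F $ n = fps_deriv G $ n"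
  shows "F $ Suc n = G $ Suc n"
  using assms by (simp del: of_nat_Suc)

text \<open>The equations express the coefficients of index \<open>Suc n\<close>, up to the nonzero
  factor \<open>Suc n\<close>, through those of index at most \<open>n\<close>. Products involve all
  lower coefficients, hence the induction over initial segments.\<close>

lemma fps_riccati_unique:
  fixes F G F' G' :: "'a::{idom,semiring_char_0} fps"
  assumes "fps_deriv F = F * G" "fps_deriv G = c * F ^ 2"
    and "fps_deriv F' = F' * G'" "fps_deriv G' = c * F' ^ 2"
    and "F $ 0 = F' $ 0" "G $ 0 = G' $ 0"
  shows "F = F' \<and> G = G'"
proof -
  have "\<forall>k\<le>n. F $ k = F' $ k \<and> G $ k = G' $ k" for n
  proof (induction n)
    case (Suc n)
    have "(F * G) $ n = (F' * G') $ n"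
      unfolding fps_mult_nth by (rule sum.cong) (use Suc in auto)
    then have "F $ Suc n = F' $ Suc n" using assms by (intro fps_nth_Suc_eqI) simp
    moreover have "(F ^ 2) $ k = (F' ^ 2) $ k" if "k \<le> n" for k
      unfolding power2_eq_square fps_mult_nth by (rule sum.cong) (use Suc that in auto)
    then have "(c * F ^ 2) $ n = (c * F' ^ 2) $ n"
      unfolding fps_mult_nth[of c] by (intro sum.cong) auto
    then have "G $ Suc n = G' $ Suc n" using assms by (intro fps_nth_Suc_eqI) simp
    ultimately show ?case using Suc by (auto simp: le_Suc_eq)
  qed (use assms in auto)
  then show ?thesis by (auto simp: fps_eq_iff)
qed

lemma fps_deriv_exp_x: "fps_deriv (exp_x c) = fps_const c * exp_x c"
proof (rule fps_ext)
  fix n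
  have "real (Suc n) * (1 / fact (Suc n)) = 1 / fact n"
    by (simp only: fact_Suc of_nat_mult) simp
  then have "of_nat (Suc n) * fps_const (1 / fact (Suc n)) = fps_const (1 / fact n :: real)"
    by (metis fps_of_nat fps_const_mult)
  then show "fps_deriv (exp_x c) $ n = (fps_const c * exp_x c) $ n"
    by (simp only: exp_x_def fps_deriv_nth fps_nth_Abs_fps fps_mult_left_const_nth Suc_eq_plus1[symmetric]
        mult.assoc[symmetric] power_Suc) (simp only: mult_ac)
qed

lemma fps_linear_ode_unique:
  fixes F G :: "'a::{idom,semiring_char_0} fps"
  assumes "fps_deriv F = fps_const c * F" "fps_deriv G = fps_const c * G" "F $ 0 = G $ 0"
  shows "F = G"
proof (rule fps_ext)
  fix n show "F $ n = G $ n"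
  proof (induction n)
    case (Suc n)
    then show ?case using assms by (intro fps_nth_Suc_eqI) simp
  qed (use assms in auto)
qed

text \<open>Both sides solve the same linear equation with initial value 1.\<close>

lemma exp_x_double: "exp_x (2 * c) = exp_x c ^ 2"
proof (rule fps_linear_ode_unique)
  show "fps_deriv (exp_x (2 * c)) = fps_const (2 * c) * exp_x (2 * c)"
    by (rule fps_deriv_exp_x)
  have "fps_const (2 * c) = 2 * fps_const c"
    by (simp add: fps_const_mult[symmetric] numeral_fps_const del: fps_const_mult)
  then show "fps_deriv (exp_x c ^ 2) = fps_const (2 * c) * exp_x c ^ 2"
    by (simp add: fps_deriv_power fps_deriv_exp_x power2_eq_square algebra_simps)
  show "exp_x (2 * c) $ 0 = (exp_x c ^ 2) $ 0"
    by (simp add: exp_x_def power2_eq_square)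
qed

section \<open>Explicit solution of the system\<close>

text \<open>The system conserves \<open>ceil_gf ^ 2 - t_var ^ 2 * floor_gf ^ 2\<close>, whose
  initial value is \<open>rho ^ 2\<close>; this is how \<open>rho\<close> enters. The candidates are
  verified directly: the second is the logarithmic derivative of the first.\<close>

lemma riccati_solution:
  defines "L \<equiv> 1 + rho - (1 - rho) * exp_x rho_t ^ 2"
    and "M \<equiv> 1 + rho + (1 - rho) * exp_x rho_t ^ 2"
  shows "floor_gf * L = 2 * rho * exp_x rho_t" "ceil_gf * L = rho * M"
proof -
  define q where "q = exp_x rho_t"
  \<comment> \<open>A true inverse: \<open>L\<close> has constant term \<open>2 * rho_t\<close>, a
    unit among the series in \<open>t\<close>.\<close>
  define J where "J = 1 / L"
  have dq: "fps_deriv q = rho * q" by (simp add: q_def rho_def fps_deriv_exp_x)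
  have drho: "fps_deriv rho = 0" by (simp add: rho_def)
  have "q $ 0 = 1" by (simp add: q_def exp_x_def)
  then have L0: "L $ 0 = 2 * rho_t" and M0: "M $ 0 = 2"
    by (simp_all add: L_def M_def q_def[symmetric] rho_def power2_eq_square)
  have JL: "J * L = 1"
    unfolding J_def by (rule fps_fps_divide_mult_cancel) (simp add: L0 rho_t_nth_0)
  then have L_nz: "L \<noteq> 0" by auto
  have dL: "fps_deriv L = rho * (L - M)" and dM: "fps_deriv M = rho * (M - L)"
    unfolding L_def M_def q_def[symmetric]
    by (simp_all add: dq drho power2_eq_square algebra_simps)
  \<comment> \<open>Differentiating \<open>J * L = 1\<close> gives the quotient rule.\<close>
  have "fps_deriv (J * L) = 0" by (simp add: JL)
  then have "fps_deriv J * L = - (J * fps_deriv L)"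
    by (simp add: add_eq_0_iff)
  also have "\<dots> = - (J * fps_deriv L) * (J * L)" by (simp add: JL)
  finally have "fps_deriv J * L = (- fps_deriv L * J ^ 2) * L"
    by (simp add: power2_eq_square mult_ac)
  then have dJ: "fps_deriv J = - fps_deriv L * J ^ 2"
    using L_nz mult_right_cancel by blast
  have two: "fps_deriv (2 :: real fps fps) = 0" by (simp add: numeral_fps_const)
  have sol: "floor_gf = 2 * rho * q * J \<and> ceil_gf = rho * M * J"
  proof (rule fps_riccati_unique)
    \<comment> \<open>Inserting \<open>J * L = 1\<close> into one summand brings both to the common
      factor \<open>J ^ 2\<close>.\<close>
    have "fps_deriv (2 * rho * q * J) = 2 * rho * (rho * q * (J * (J * L)) + q * (rho * (M - L) * J ^ 2))"
      unfolding JL by (simp add: dq drho dJ dL two algebra_simps)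
    then show "fps_deriv (2 * rho * q * J) = 2 * rho * q * J * (rho * M * J)"
      by (simp add: power2_eq_square algebra_simps)
    have "fps_deriv (rho * M * J) = rho * (rho * (M - L) * (J * (J * L)) + M * (rho * (M - L) * J ^ 2))"
      unfolding JL by (simp add: dM drho dJ dL algebra_simps)
    also have "\<dots> = rho ^ 2 * J ^ 2 * (M ^ 2 - L ^ 2)"
      by (simp add: power2_eq_square algebra_simps)
    also have "M ^ 2 - L ^ 2 = 4 * (1 - rho ^ 2) * q ^ 2"
      unfolding L_def M_def q_def[symmetric] by algebra
    also have "1 - rho ^ 2 = t_var ^ 2" by (simp add: rho_power2)
    finally show "fps_deriv (rho * M * J) = t_var ^ 2 * (2 * rho * q * J) ^ 2"
      by (simp add: power_mult_distrib mult_ac)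
    have J0: "J $ 0 * (2 * rho_t) = 1"
      using arg_cong[OF JL, of "\<lambda>f. f $ 0"] by (simp add: L0)
    show "floor_gf $ 0 = (2 * rho * q * J) $ 0"
      using J0 \<open>q $ 0 = 1\<close> by (simp add: floor_gf_def perm_gf_nth_0 rho_def mult_ac)
    show "ceil_gf $ 0 = (rho * M * J) $ 0"
      using J0 M0 by (simp add: ceil_gf_def perm_gf_nth_0 rho_def mult_ac)
  qed (rule fps_deriv_floor_gf fps_deriv_ceil_gf)+
  show "floor_gf * L = 2 * rho * exp_x rho_t"
    by (simp only: conjunct1[OF sol] mult.assoc JL mult_1_right q_def)
  show "ceil_gf * L = rho * M"
    by (simp only: conjunct2[OF sol] mult.assoc JL mult_1_right)
qed

section \<open>The closed forms\<close>

theorem theorem2p3: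
  shows "B_gf =
           (1 + rho + 2 * t_var * exp_x rho_t + (1 - rho) * exp_x (2 * rho_t)) /
           (1 + rho - t_var ^ 2 + (1 - rho - t_var ^ 2) * exp_x (2 * rho_t))
         \<and> A_gf = (1 - t_var) * B_gf
         \<and> A_gf = (1 - t_var) *
           ((1 + rho + 2 * t_var * exp_x rho_t + (1 - rho) * exp_x (2 * rho_t)) /
            (1 + rho - t_var ^ 2 + (1 - rho - t_var ^ 2) * exp_x (2 * rho_t)))"
proof -
  let ?N = "1 + rho + 2 * t_var * exp_x rho_t + (1 - rho) * exp_x (2 * rho_t)"
  let ?D = "1 + rho - t_var ^ 2 + (1 - rho - t_var ^ 2) * exp_x (2 * rho_t)"
  define L where "L = 1 + rho - (1 - rho) * exp_x rho_t ^ 2"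
  have rho_nz: "rho \<noteq> 0"
    using rho_t_nth_0 by (auto simp: rho_def)
  have t2: "t_var ^ 2 = 1 - rho ^ 2" by (simp add: rho_power2)
  \<comment> \<open>By \<open>t2\<close>, \<open>1 + rho - t_var ^ 2\<close> is
    \<open>rho * (1 + rho)\<close> and \<open>1 - rho - t_var ^ 2\<close> is
    \<open>- rho * (1 - rho)\<close>.\<close>
  have D: "?D = rho * L"
    unfolding L_def exp_x_double t2 by (simp add: power2_eq_square algebra_simps)
  \<comment> \<open>Here \<open>rho ^ 2\<close> arises as
    \<open>(1 + t_var) * (1 - t_var)\<close>.\<close>
  have B: "rho ^ 2 * B_gf = ceil_gf + t_var * floor_gf"
    unfolding A_gf_eq_floor_ceil[symmetric] A_gf_eq_B_gf rho_power2
    by (simp add: power2_eq_square algebra_simps)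
  have "rho ^ 2 * (B_gf * ?D) = rho * (L * (rho ^ 2 * B_gf))"
    unfolding D by (simp only: mult_ac)
  also have "\<dots> = rho * (ceil_gf * L + t_var * (floor_gf * L))"
    unfolding B by (simp only: distrib_left mult_ac)
  also have "\<dots> = rho ^ 2 * ?N"
    unfolding riccati_solution[folded L_def] exp_x_double by (simp add: power2_eq_square algebra_simps)
  finally have "B_gf * ?D = ?N" using rho_nz by simp
  \<comment> \<open>The denominator has constant coefficient 2, so the quotient is genuine and
    \<open>?D\<close> can be cancelled.\<close>
  also have "?N = ?N / ?D * ?D"
    by (rule fps_fps_divide_mult_cancel[symmetric]) (simp only: denominator_nth_0_0)
  finally have "B_gf * ?D = ?N / ?D * ?D" .
  moreover have "?D \<noteq> 0" using denominator_nth_0_0 by force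
  ultimately have "B_gf = ?N / ?D" using mult_right_cancel by blast
  then show ?thesis using A_gf_eq_B_gf by simp
qed

end
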